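(* Let $\gamma,\eta\ge 1$ be integers, let $\tilde F,\tilde G\in\mathbb{R}^{\gamma\times\eta}$, and let $\tilde Y=\tilde F*\tilde G\in\mathbb{R}^{(2\gamma-1)\times(2\eta-1)}$ be their 2D linear convolution. If $f=\mathrm{vec}(\tilde F)$ and $g=\mathrm{vec}(\tilde G)$, then $$f*g=Q^{(\gamma,\eta)}\,\mathrm{vec}(\tilde Y).$$
   Context: All indices start at $0$. The 1D linear convolution of $f,g\in\mathbb{R}^{n}$ is $f*g\in\mathbb{R}^{2n-1}$ with $(f*g)_k=\sum_i f_i g_{k-i}$, the sum over all $i$ with $0\le i\le n-1$ and $0\le k-i\le n-1$. The 2D linear convolution of $\tilde F,\tilde G\in\mathbb{R}^{\gamma\times\eta}$ has entries $\tilde y_{ab}=\sum_{i}\sum_{j}\tilde f_{ij}\,\tilde g_{a-i,b-j}$, the sum over all $(i,j)$ for which both factors have indices in range. $\mathrm{vec}$ stacks a matrix row by row: for a matrix $Z$ with $q$ columns, $\mathrm{vec}(Z)_{iq+j}=z_{ij}$. With $n=\gamma\eta$, the overlap-add recomposition matrix $Q^{(\gamma,\eta)}\in\mathbb{R}^{(2n-1)\times(2\gamma-1)(2\eta-1)}$ is defined by $q^{(\gamma,\eta)}_{ij}=1$ if $i=j-(\eta-1)\lfloor j/(2\eta-1)\rfloor$ and $q^{(\gamma,\eta)}_{ij}=0$ otherwise. *)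

theory Defs
  imports Complex_Main "Jordan_Normal_Form.Matrix"
begin

(* The convolutions are defined for arbitrary sizes; for two factors in R^n the result has
   length n + n - 1 = 2n - 1, and likewise in each of the two dimensions for matrices.
   The guards i \<le> k (a \<ge> i, b \<ge> j) keep the natural-number subtractions exact. *)

definition lin_conv :: "real vec \<Rightarrow> real vec \<Rightarrow> real vec" where
  "lin_conv f g = vec (dim_vec f + dim_vec g - 1)
     (\<lambda>k. \<Sum>i | i < dim_vec f \<and> i \<le> k \<and> k - i < dim_vec g. f $ i * g $ (k - i))"

definition lin_conv2 :: "real mat \<Rightarrow> real mat \<Rightarrow> real mat" where
  "lin_conv2 F G = mat (dim_row F + dim_row G - 1) (dim_col F + dim_col G - 1)
     (\<lambda>(a, b). \<Sum>i | i < dim_row F \<and> i \<le> a \<and> a - i < dim_row G.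
                \<Sum>j | j < dim_col F \<and> j \<le> b \<and> b - j < dim_col G.
                  F $$ (i, j) * G $$ (a - i, b - j))"

(* Row-major stacking: the entry with index i * dim_col Z + j is Z $$ (i, j). *)

definition vec_rows :: "'a mat \<Rightarrow> 'a vec" where
  "vec_rows Z = vec (dim_row Z * dim_col Z) (\<lambda>k. Z $$ (k div dim_col Z, k mod dim_col Z))"

lemma vec_rows_index:
  assumes "i < dim_row Z" and "j < dim_col Z"
  shows "vec_rows Z $ (i * dim_col Z + j) = Z $$ (i, j)"
proof -
  have "i * dim_col Z + j < Suc i * dim_col Z"
    using assms(2) by simp
  also have "\<dots> \<le> dim_row Z * dim_col Z"
    using assms(1) by (intro mult_le_mono1) simp
  finally show ?thesis
    using assms(2) by (simp add: vec_rows_def)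
qed

(* div is the floor of the quotient, and the outer subtraction never truncates because
   (\<eta> - 1) * (j div (2 * \<eta> - 1)) \<le> j. *)

definition overlap_add_mat :: "nat \<Rightarrow> nat \<Rightarrow> real mat" where
  "overlap_add_mat \<gamma> \<eta> =
     mat (2 * (\<gamma> * \<eta>) - 1) ((2 * \<gamma> - 1) * (2 * \<eta> - 1))
       (\<lambda>(i, j). if i = j - (\<eta> - 1) * (j div (2 * \<eta> - 1)) then 1 else 0)"

end

theory Submission
  imports Defs
begin

text \<open>
  A two-dimensional convolution collects the products of entries at \<open>(i, j)\<close> and \<open>(i', j')\<close>
  according to the pair \<open>(i + i', j + j')\<close>. Row-major stacking sends these positions to
  \<open>i * \<eta> + j\<close> and \<open>i' * \<eta> + j'\<close>, so the one-dimensional convolution collects the same products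
  according to \<open>(i + i') * \<eta> + (j + j')\<close>, which depends on that pair only. Thus the entry of the
  one-dimensional convolution at \<open>k\<close> is the sum of the two-dimensional entries at all \<open>(a, b)\<close>
  with \<open>k = a * \<eta> + b\<close>.

  The overlap-add matrix performs exactly this summation. The stacked two-dimensional
  convolution has its entry \<open>(a, b)\<close> at \<open>a * (2 * \<eta> - 1) + b\<close>, and subtracting \<open>(\<eta> - 1) * a\<close>
  turns this into \<open>a * \<eta> + b\<close>. The matrix merges positions because the column sums \<open>j + j'\<close>
  reach \<open>2 * \<eta> - 2\<close>, so that consecutive blocks of length \<open>2 * \<eta> - 1\<close> placed at distance \<open>\<eta>\<close>
  overlap.

  In the proof, convolutions are written as unrestricted sums of products filtered by the condition
  on the index sum (\<open>lin_conv_index\<close>, \<open>lin_conv2_index\<close>); the order of summation can then be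
  changed freely, and both sides become the same sum over \<open>(i, j, i', j')\<close>.
\<close>

lemma sum_row_major:
  fixes h :: "nat \<Rightarrow> 'a::comm_monoid_add"
  shows "(\<Sum>p<m * n. h p) = (\<Sum>i<m. \<Sum>j<n. h (i * n + j))"
proof -
  have "(\<Sum>p = i * n..<i * n + n. h p) = (\<Sum>j<n. h (i * n + j))" for i
    using sum.shift_bounds_nat_ivl[of h 0 "i * n" n]
    by (simp add: atLeast0LessThan add.commute)
  then show ?thesis
    using sum.nat_group[of h n m] by simp
qed

lemma dim_vec_rows: "dim_vec (vec_rows Z) = dim_row Z * dim_col Z"
  by (simp add: vec_rows_def)

text \<open>The guards in the definitions of the convolutions say that \<open>k - p\<close> is the one admissible
  second index; the next lemma trades them for a filter that is symmetric in both indices.\<close>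

lemma sum_filter_add_eq:
  fixes h :: "nat \<Rightarrow> 'a::comm_monoid_add"
  shows "(\<Sum>q<n. if p + q = k then h q else 0) = (if p \<le> k \<and> k - p < n then h (k - p) else 0)"
proof (cases "p \<le> k")
  case True
  then have "(p + q = k) = (q = k - p)" for q
    by auto
  then show ?thesis
    using True by (simp add: sum.delta)
next
  case False
  then show ?thesis
    by simp
qed

lemma sum_antidiagonal:
  fixes h :: "nat \<Rightarrow> nat \<Rightarrow> 'a::comm_monoid_add"
  shows "(\<Sum>i | i < m \<and> i \<le> k \<and> k - i < n. h i (k - i))
    = (\<Sum>i<m. \<Sum>i'<n. if i + i' = k then h i i' else 0)"
proof -
  have "{i. i < m \<and> i \<le> k \<and> k - i < n} = {i \<in> {..<m}. i \<le> k \<and> k - i < n}"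
    by auto
  then have "(\<Sum>i | i < m \<and> i \<le> k \<and> k - i < n. h i (k - i))
      = (\<Sum>i<m. if i \<le> k \<and> k - i < n then h i (k - i) else 0)"
    by (metis (no_types) sum.inter_filter finite_lessThan)
  then show ?thesis
    by (simp add: sum_filter_add_eq)
qed

lemma lin_conv_index:
  assumes "k < dim_vec f + dim_vec g - 1"
  shows "lin_conv f g $ k
    = (\<Sum>p<dim_vec f. \<Sum>q<dim_vec g. if p + q = k then f $ p * g $ q else 0)"
  using assms sum_antidiagonal[where h = "\<lambda>p q. f $ p * g $ q"]
  by (simp add: lin_conv_def)

lemma lin_conv2_index:
  assumes "a < dim_row F + dim_row G - 1" and "b < dim_col F + dim_col G - 1"
  shows "lin_conv2 F G $$ (a, b)
    = (\<Sum>i<dim_row F. \<Sum>i'<dim_row G. \<Sum>j<dim_col F. \<Sum>j'<dim_col G.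
        if i + i' = a \<and> j + j' = b then F $$ (i, j) * G $$ (i', j') else 0)"
proof -
  have "lin_conv2 F G $$ (a, b)
      = (\<Sum>i | i < dim_row F \<and> i \<le> a \<and> a - i < dim_row G.
          \<Sum>j<dim_col F. \<Sum>j'<dim_col G.
            if j + j' = b then F $$ (i, j) * G $$ (a - i, j') else 0)"
    using assms sum_antidiagonal[where h = "\<lambda>j j'. F $$ (i, j) * G $$ (a - i, j')" for i]
    by (simp add: lin_conv2_def)
  also have "\<dots> = (\<Sum>i<dim_row F. \<Sum>i'<dim_row G. if i + i' = a
      then \<Sum>j<dim_col F. \<Sum>j'<dim_col G.
        if j + j' = b then F $$ (i, j) * G $$ (i', j') else 0
      else 0)"
    by (rule sum_antidiagonal)
  also have "\<dots> = (\<Sum>i<dim_row F. \<Sum>i'<dim_row G. \<Sum>j<dim_col F. \<Sum>j'<dim_col G.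
        if i + i' = a \<and> j + j' = b then F $$ (i, j) * G $$ (i', j') else 0)"
    by (intro sum.cong refl) simp
  finally show ?thesis .
qed

text \<open>In column \<open>a * (2 * \<eta> - 1) + b\<close> the quotient by \<open>2 * \<eta> - 1\<close> is \<open>a\<close>, so the single nonzero
  entry of that column lies in row \<open>a * \<eta> + b\<close>.\<close>

lemma overlap_add_mat_mult_index:
  assumes "\<eta> \<ge> 1" and "Z \<in> carrier_mat (2 * \<gamma> - 1) (2 * \<eta> - 1)" and "k < 2 * (\<gamma> * \<eta>) - 1"
  shows "(overlap_add_mat \<gamma> \<eta> *\<^sub>v vec_rows Z) $ k
    = (\<Sum>a<2 * \<gamma> - 1. \<Sum>b<2 * \<eta> - 1. if a * \<eta> + b = k then Z $$ (a, b) else 0)"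
proof -
  define M N where "M = 2 * \<gamma> - 1" and "N = 2 * \<eta> - 1"
  have Z: "dim_row Z = M" "dim_col Z = N"
    using assms(2) by (auto simp: M_def N_def)
  have N: "N = \<eta> + (\<eta> - 1)"
    using assms(1) by (simp add: N_def)
  have Q: "overlap_add_mat \<gamma> \<eta> = mat (2 * (\<gamma> * \<eta>) - 1) (M * N)
      (\<lambda>(i, j). if i = j - (\<eta> - 1) * (j div N) then 1 else 0)"
    by (simp add: overlap_add_mat_def M_def N_def)
  have "(overlap_add_mat \<gamma> \<eta> *\<^sub>v vec_rows Z) $ k
      = (\<Sum>p<M * N. (if k = p - (\<eta> - 1) * (p div N) then 1 else 0) * vec_rows Z $ p)"
    using assms(3) Z
    by (simp add: Q scalar_prod_def vec_rows_def atLeast0LessThan)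
  also have "\<dots> = (\<Sum>a<M. \<Sum>b<N. (if k = a * N + b - (\<eta> - 1) * ((a * N + b) div N) then 1 else 0)
      * vec_rows Z $ (a * N + b))"
    by (rule sum_row_major)
  also have "\<dots> = (\<Sum>a<M. \<Sum>b<N. if a * \<eta> + b = k then Z $$ (a, b) else 0)"
  proof (intro sum.cong refl)
    fix a b
    assume "a \<in> {..<M}" and b: "b \<in> {..<N}"
    then have "vec_rows Z $ (a * N + b) = Z $$ (a, b)"
      using vec_rows_index[of a Z b] Z by simp
    moreover have "(a * N + b) div N = a"
      using b by simp
    moreover have "a * N + b - (\<eta> - 1) * a = a * \<eta> + b"
      unfolding N by (simp add: distrib_left mult.commute)
    ultimately show "(if k = a * N + b - (\<eta> - 1) * ((a * N + b) div N) then 1 else 0)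
        * vec_rows Z $ (a * N + b) = (if a * \<eta> + b = k then Z $$ (a, b) else 0)"
      by auto
  qed
  finally show ?thesis
    by (simp add: M_def N_def)
qed

lemma lin_conv_vec_rows_index:
  assumes F: "F \<in> carrier_mat \<gamma> \<eta>" and G: "G \<in> carrier_mat \<gamma> \<eta>" and k: "k < 2 * (\<gamma> * \<eta>) - 1"
  shows "lin_conv (vec_rows F) (vec_rows G) $ k
    = (\<Sum>i<\<gamma>. \<Sum>i'<\<gamma>. \<Sum>j<\<eta>. \<Sum>j'<\<eta>.
        if (i + i') * \<eta> + (j + j') = k then F $$ (i, j) * G $$ (i', j') else 0)"
proof -
  have dims: "dim_vec (vec_rows F) = \<gamma> * \<eta>" "dim_vec (vec_rows G) = \<gamma> * \<eta>"
    using F G by (auto simp: dim_vec_rows)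
  have "lin_conv (vec_rows F) (vec_rows G) $ k
      = (\<Sum>p<\<gamma> * \<eta>. \<Sum>q<\<gamma> * \<eta>. if p + q = k then vec_rows F $ p * vec_rows G $ q else 0)"
    using lin_conv_index[of k "vec_rows F" "vec_rows G"] k dims by simp
  also have "\<dots> = (\<Sum>i<\<gamma>. \<Sum>j<\<eta>. \<Sum>i'<\<gamma>. \<Sum>j'<\<eta>. if i * \<eta> + j + (i' * \<eta> + j') = k
      then vec_rows F $ (i * \<eta> + j) * vec_rows G $ (i' * \<eta> + j') else 0)"
    unfolding sum_row_major ..
  also have "\<dots> = (\<Sum>i<\<gamma>. \<Sum>j<\<eta>. \<Sum>i'<\<gamma>. \<Sum>j'<\<eta>.
        if (i + i') * \<eta> + (j + j') = k then F $$ (i, j) * G $$ (i', j') else 0)"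
  proof (intro sum.cong refl)
    fix i j i' j'
    assume "i \<in> {..<\<gamma>}" "j \<in> {..<\<eta>}" "i' \<in> {..<\<gamma>}" "j' \<in> {..<\<eta>}"
    then have "vec_rows F $ (i * \<eta> + j) = F $$ (i, j)" "vec_rows G $ (i' * \<eta> + j') = G $$ (i', j')"
      using vec_rows_index[of i F j] vec_rows_index[of i' G j'] F G by auto
    moreover have "i * \<eta> + j + (i' * \<eta> + j') = (i + i') * \<eta> + (j + j')"
      by (simp add: algebra_simps)
    ultimately show "(if i * \<eta> + j + (i' * \<eta> + j') = k
        then vec_rows F $ (i * \<eta> + j) * vec_rows G $ (i' * \<eta> + j') else 0)
      = (if (i + i') * \<eta> + (j + j') = k then F $$ (i, j) * G $$ (i', j') else 0)"
      by simp
  qed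
  also have "\<dots> = (\<Sum>i<\<gamma>. \<Sum>i'<\<gamma>. \<Sum>j<\<eta>. \<Sum>j'<\<eta>.
        if (i + i') * \<eta> + (j + j') = k then F $$ (i, j) * G $$ (i', j') else 0)"
    by (intro sum.cong refl sum.swap)
  finally show ?thesis .
qed

text \<open>Each product of entries contributes to exactly one \<open>(a, b)\<close>, so a filtered sum over \<open>(a, b)\<close>
  of convolution entries only moves the filter onto the index sums.\<close>

lemma sum_filter_lin_conv2:
  assumes F: "F \<in> carrier_mat \<gamma> \<eta>" and G: "G \<in> carrier_mat \<gamma> \<eta>"
  shows "(\<Sum>a<2 * \<gamma> - 1. \<Sum>b<2 * \<eta> - 1. if P a b then lin_conv2 F G $$ (a, b) else 0)
    = (\<Sum>i<\<gamma>. \<Sum>i'<\<gamma>. \<Sum>j<\<eta>. \<Sum>j'<\<eta>.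
        if P (i + i') (j + j') then F $$ (i, j) * G $$ (i', j') else 0)"
proof -
  define T where "T = {..<\<gamma>} \<times> {..<\<gamma>} \<times> {..<\<eta>} \<times> {..<\<eta>}"
  define S where "S = {..<2 * \<gamma> - 1} \<times> {..<2 * \<eta> - 1}"
  define s :: "nat \<times> nat \<times> nat \<times> nat \<Rightarrow> nat \<times> nat"
    where "s = (\<lambda>(i, i', j, j'). (i + i', j + j'))"
  define h where "h = (\<lambda>(i, i', j, j'). if P (i + i') (j + j')
    then F $$ (i, j) * G $$ (i', j') else 0)"
  have fin: "finite T" "finite S"
    by (simp_all add: T_def S_def)
  have "s ` T \<subseteq> S"
    by (auto simp: s_def T_def S_def)
  have "(\<Sum>a<2 * \<gamma> - 1. \<Sum>b<2 * \<eta> - 1. if P a b then lin_conv2 F G $$ (a, b) else 0)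
      = (\<Sum>(a, b)\<in>S. if P a b then lin_conv2 F G $$ (a, b) else 0)"
    by (simp add: S_def sum.cartesian_product)
  also have "\<dots> = (\<Sum>x\<in>S. \<Sum>t | t \<in> T \<and> s t = x. h t)"
  proof (rule sum.cong)
    fix x
    assume "x \<in> S"
    then obtain a b where x: "x = (a, b)" and ab: "a < 2 * \<gamma> - 1" "b < 2 * \<eta> - 1"
      by (auto simp: S_def)
    have "lin_conv2 F G $$ (a, b)
        = (\<Sum>i<\<gamma>. \<Sum>i'<\<gamma>. \<Sum>j<\<eta>. \<Sum>j'<\<eta>.
            if i + i' = a \<and> j + j' = b then F $$ (i, j) * G $$ (i', j') else 0)"
      using lin_conv2_index[of a F G b] ab F G by auto
    also have "\<dots> = (\<Sum>(i, i', j, j')\<in>T.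
        if i + i' = a \<and> j + j' = b then F $$ (i, j) * G $$ (i', j') else 0)"
      by (simp add: T_def sum.cartesian_product)
    finally have "(if P a b then lin_conv2 F G $$ (a, b) else 0)
        = (\<Sum>t\<in>T. if s t = x then h t else 0)"
      by (auto simp: s_def h_def x intro!: sum.cong sum.neutral)
    then show "(case x of (a, b) \<Rightarrow> if P a b then lin_conv2 F G $$ (a, b) else 0)
        = (\<Sum>t | t \<in> T \<and> s t = x. h t)"
      using fin by (simp add: x sum.inter_filter)
  qed simp
  also have "\<dots> = sum h T"
    using fin \<open>s ` T \<subseteq> S\<close> by (rule sum.group)
  also have "\<dots> = (\<Sum>i<\<gamma>. \<Sum>i'<\<gamma>. \<Sum>j<\<eta>. \<Sum>j'<\<eta>.
        if P (i + i') (j + j') then F $$ (i, j) * G $$ (i', j') else 0)"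
    by (simp add: T_def h_def sum.cartesian_product)
  finally show ?thesis .
qed

theorem theorem7p1:
  fixes \<gamma> \<eta> :: nat and F G Y :: "real mat" and f g :: "real vec"
  assumes "\<gamma> \<ge> 1" and "\<eta> \<ge> 1"
    and "F \<in> carrier_mat \<gamma> \<eta>" and "G \<in> carrier_mat \<gamma> \<eta>"
    and "Y = lin_conv2 F G"
    and "f = vec_rows F" and "g = vec_rows G"
  shows "lin_conv f g = overlap_add_mat \<gamma> \<eta> *\<^sub>v vec_rows Y"
proof (rule eq_vecI)
  have dims: "dim_vec f = \<gamma> * \<eta>" "dim_vec g = \<gamma> * \<eta>"
    using assms by (auto simp: dim_vec_rows)
  show "dim_vec (lin_conv f g) = dim_vec (overlap_add_mat \<gamma> \<eta> *\<^sub>v vec_rows Y)"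
    by (simp add: lin_conv_def overlap_add_mat_def dims mult_2)
  fix k
  assume "k < dim_vec (overlap_add_mat \<gamma> \<eta> *\<^sub>v vec_rows Y)"
  then have k: "k < 2 * (\<gamma> * \<eta>) - 1"
    by (simp add: overlap_add_mat_def)
  have Y: "Y \<in> carrier_mat (2 * \<gamma> - 1) (2 * \<eta> - 1)"
    using assms by (auto simp: lin_conv2_def mult_2)
  have "(overlap_add_mat \<gamma> \<eta> *\<^sub>v vec_rows Y) $ k
      = (\<Sum>a<2 * \<gamma> - 1. \<Sum>b<2 * \<eta> - 1. if a * \<eta> + b = k then Y $$ (a, b) else 0)"
    by (rule overlap_add_mat_mult_index[OF \<open>\<eta> \<ge> 1\<close> Y k])
  also have "\<dots> = (\<Sum>i<\<gamma>. \<Sum>i'<\<gamma>. \<Sum>j<\<eta>. \<Sum>j'<\<eta>.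
        if (i + i') * \<eta> + (j + j') = k then F $$ (i, j) * G $$ (i', j') else 0)"
    unfolding \<open>Y = lin_conv2 F G\<close>
    using sum_filter_lin_conv2[OF assms(3,4), of "\<lambda>a b. a * \<eta> + b = k"] .
  also have "\<dots> = lin_conv f g $ k"
    using lin_conv_vec_rows_index[OF assms(3,4) k] assms(6,7) by simp
  finally show "lin_conv f g $ k = (overlap_add_mat \<gamma> \<eta> *\<^sub>v vec_rows Y) $ k" ..
qed

end
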